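(* Let $n$ be a positive integer, let $p\in\,]0,\infty]$, and let $I=[a,b]$ with $a<b$ be a bounded segment of the real line. Then $$D^{*}(n,p,n!,I)=D^{**}(n,p,I),$$ that is, $$\inf\{\|f\|_p : f\in\mathcal{D}^n(I),\ m_n(f)=n!\}=\inf\{\|Q\|_p : Q\in\mathcal{P}_n\}.$$
   Context: For a positive integer $n$ and $I=[a,b]$, $a<b$, $\mathcal{D}^n(I)$ denotes the set of real functions $f$ on $I$ whose successive derivatives $f^{(k)}$ are defined and continuous on $I$ for $0\leq k\leq n-1$ (one-sided derivatives at the endpoints), and whose $n$-th derivative $f^{(n)}$ is defined on the open interval $]a,b[$ (with $f^{(n)}$ not assumed continuous). Put $m_n(f)=\inf_{a<t<b}|f^{(n)}(t)|$. For $0<p<\infty$, $\|f\|_p=\left(\int_a^b|f(t)|^p\,dt\right)^{1/p}$, and $\|f\|_\infty=\max_{I}|f|$. $\mathcal{P}_n$ is the set of monic polynomials of degree $n$ with real coefficients, identified with the corresponding polynomial functions on $I$. For $\lambda>0$, $D^{*}(n,p,\lambda,I)=\inf\{\|f\|_p : f\in\mathcal{D}^n(I),\ m_n(f)=\lambda\}$, and $D^{**}(n,p,I)=\inf\{\|Q\|_p : Q\in\mathcal{P}_n\}$. *)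

theory Defs
  imports "HOL-Analysis.Analysis" "HOL-Computational_Algebra.Polynomial"
begin

text \<open>Functions on \<open>[a, b]\<close> are represented by total functions \<open>real \<Rightarrow> real\<close>; all notions below
  depend only on the values on \<open>[a, b]\<close>.\<close>

text \<open>Iterated derivative relative to \<open>S\<close>. For \<open>S = {a..b}\<close> it is one-sided at the endpoints and the
  ordinary derivative at interior points. The value is unspecified where the derivative does
  not exist; existence is required separately.\<close>

primrec deriv_within :: "real set \<Rightarrow> nat \<Rightarrow> (real \<Rightarrow> real) \<Rightarrow> real \<Rightarrow> real" where
  "deriv_within S 0 f = f"
| "deriv_within S (Suc k) f = (\<lambda>x. vector_derivative (deriv_within S k f) (at x within S))"

definition D_class :: "nat \<Rightarrow> real \<Rightarrow> real \<Rightarrow> (real \<Rightarrow> real) set" where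
  "D_class n a b = {f.
     (\<forall>k. Suc k < n \<longrightarrow> deriv_within {a..b} k f differentiable_on {a..b}) \<and>
     (\<forall>k<n. continuous_on {a..b} (deriv_within {a..b} k f)) \<and>
     deriv_within {a..b} (n - 1) f differentiable_on {a<..<b}}"

definition m_inf :: "nat \<Rightarrow> real \<Rightarrow> real \<Rightarrow> (real \<Rightarrow> real) \<Rightarrow> real" where
  "m_inf n a b f = (INF t\<in>{a<..<b}. \<bar>deriv_within {a..b} n f t\<bar>)"

text \<open>Only used for \<open>0 < p \<le> \<infinity>\<close> and \<open>f\<close> continuous on \<open>[a, b]\<close>, so the integrand is continuous
  and the supremum is a maximum.\<close>

definition Lp_norm :: "ereal \<Rightarrow> real \<Rightarrow> real \<Rightarrow> (real \<Rightarrow> real) \<Rightarrow> real" where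
  "Lp_norm p a b f =
     (if p = \<infinity> then (SUP t\<in>{a..b}. \<bar>f t\<bar>)
      else (integral {a..b} (\<lambda>t. \<bar>f t\<bar> powr real_of_ereal p)) powr (1 / real_of_ereal p))"

definition monic_polys :: "nat \<Rightarrow> real poly set" where
  "monic_polys n = {Q. degree Q = n \<and> lead_coeff Q = 1}"

definition D_star :: "nat \<Rightarrow> ereal \<Rightarrow> real \<Rightarrow> real \<Rightarrow> real \<Rightarrow> real" where
  "D_star n p c a b = Inf {Lp_norm p a b f | f. f \<in> D_class n a b \<and> m_inf n a b f = c}"

definition D_star_star :: "nat \<Rightarrow> ereal \<Rightarrow> real \<Rightarrow> real \<Rightarrow> real" where
  "D_star_star n p a b = Inf {Lp_norm p a b (poly Q) | Q. Q \<in> monic_polys n}"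

end

theory Submission imports Defs begin

text \<open>Polynomials have a constant \<open>n\<close>-th derivative, so the right-hand side is an infimum over a
  subset of the functions on the left. For the other inequality the norm is irrelevant: every
  admissible \<open>f\<close> dominates some monic polynomial \<open>Q\<close> of degree \<open>n\<close> \<^emph>\<open>pointwise\<close>,
  \<open>\<bar>Q\<bar> \<le> \<bar>f\<bar>\<close> on \<open>[a, b]\<close> (\<open>monic_poly_below\<close>), and each of the norms is monotone.

  The polynomial is built one root at a time. Choose \<open>c\<close> where \<open>\<bar>f\<bar>\<close> is smallest. Either
  \<open>f c = 0\<close> or \<open>f\<close> has constant sign, and in both cases \<open>\<bar>f x - f c\<bar> \<le> \<bar>f x\<bar>\<close>. The divided
  difference \<open>v x = (f x - f c) / (x - c)\<close> equals the integral of \<open>f' (c + t (x - c))\<close> over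
  \<open>0 \<le> t \<le> 1\<close>, so it has one derivative less than \<open>f\<close>, and its derivative of order \<open>n - 1\<close> is an
  average of values of the \<open>n\<close>-th derivative of \<open>f\<close> against the weight \<open>t ^ (n - 1)\<close>; the lower
  bound \<open>n!\<close> thereby becomes \<open>(n - 1)!\<close>. If \<open>Q'\<close> is a monic polynomial of degree \<open>n - 1\<close> below
  \<open>v\<close>, then \<open>(x - c) Q'\<close> is one below \<open>f\<close>. For \<open>n = 1\<close> the polynomial \<open>x - c\<close> itself works, because
  \<open>\<bar>f x - f c\<bar> \<ge> \<bar>x - c\<bar>\<close>.

  As the \<open>n\<close>-th derivative need not be integrable, that average is not literally available.
  The lower bound is therefore carried along as one for the difference quotients of the
  continuous derivative of order \<open>n - 1\<close>. By the mean value theorem this derivative is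
  injective, hence monotone, so \<open>\<bar>f\<^sup>(\<^sup>n\<^sup>)\<bar> \<ge> n!\<close> gives the one-sided bound for \<open>f\<close> or for \<open>- f\<close>
  (\<open>abs_deriv_ge_imp_slope_ge\<close>).\<close>

section \<open>Monic polynomials below a function with a large derivative\<close>

lemma exists_abs_diff_le_abs:
  fixes u :: "real \<Rightarrow> real"
  assumes "a \<le> b" and cont: "continuous_on {a..b} u"
  obtains c where "c \<in> {a..b}" "\<And>x. x \<in> {a..b} \<Longrightarrow> \<bar>u x - u c\<bar> \<le> \<bar>u x\<bar>"
proof -
  have "\<exists>c\<in>{a..b}. \<forall>x\<in>{a..b}. \<bar>u c\<bar> \<le> \<bar>u x\<bar>"
    using assms by (intro continuous_attains_inf continuous_intros) auto
  then obtain c where c: "c \<in> {a..b}" and min: "\<And>x. x \<in> {a..b} \<Longrightarrow> \<bar>u c\<bar> \<le> \<bar>u x\<bar>"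
    by blast
  have "\<bar>u x - u c\<bar> \<le> \<bar>u x\<bar>" if x: "x \<in> {a..b}" for x
  proof (rule ccontr)
    assume "\<not> ?thesis"
    \<comment> \<open>Then \<open>u c\<close> and \<open>u x\<close> have opposite signs, and a zero between them contradicts minimality.\<close>
    hence opp: "u c < 0 \<and> 0 < u x \<or> u x < 0 \<and> 0 < u c"
      using min[OF x] by linarith
    have conn: "connected (u ` {a..b})"
      by (intro connected_continuous_image cont) auto
    have "0 \<in> u ` {a..b}"
      using opp connectedD_interval[OF conn, of "u c" "u x" 0]
        connectedD_interval[OF conn, of "u x" "u c" 0] c x by auto
    then obtain z where "z \<in> {a..b}" "u z = 0" by auto
    thus False using min[of z] opp by auto
  qed
  with c that show thesis by blast
qed

text \<open>The integral is the \<open>k\<close>-th derivative of \<open>x \<mapsto> (u x - u c) / (x - c)\<close> when \<open>w\<close> is the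
  derivative of \<open>u\<close> of order \<open>k + 1\<close>.\<close>

definition quotient_deriv :: "real \<Rightarrow> nat \<Rightarrow> (real \<Rightarrow> real) \<Rightarrow> real \<Rightarrow> real" where
  "quotient_deriv c k w x = integral {0..1} (\<lambda>t. t ^ k * w (c + t * (x - c)))"

lemma convex_step_in_Icc:
  fixes a b c t x :: real
  assumes "c \<in> {a..b}" "x \<in> {a..b}" "t \<in> {0..1}"
  shows "c + t * (x - c) \<in> {a..b}"
proof -
  have "(1 - t) *\<^sub>R c + t *\<^sub>R x \<in> {a..b}"
    using assms by (intro convexD_alt convex_real_interval) auto
  thus ?thesis by (simp add: algebra_simps)
qed

lemma continuous_on_quotient_integrand:
  fixes w :: "real \<Rightarrow> real"
  assumes cont: "continuous_on {a..b} w" and c: "c \<in> {a..b}"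
  shows "continuous_on ({a..b} \<times> cbox 0 1) (\<lambda>(x, t). t ^ k * w (c + t * (x - c)))"
proof -
  have "continuous_on ({a..b} \<times> cbox 0 1) (\<lambda>z. w (c + snd z * (fst z - c)))"
  proof (rule continuous_on_compose2[OF cont])
    show "(\<lambda>z. c + snd z * (fst z - c)) ` ({a..b} \<times> cbox 0 1) \<subseteq> {a..b}"
      using convex_step_in_Icc[OF c] by (intro image_subsetI) (simp add: mem_Times_iff)
  qed (intro continuous_intros)
  thus ?thesis
    by (auto simp: split_beta intro!: continuous_intros)
qed

lemma quotient_integrand_integrable:
  fixes w :: "real \<Rightarrow> real"
  assumes cont: "continuous_on {a..b} w" and c: "c \<in> {a..b}" and x: "x \<in> {a..b}"
  shows "(\<lambda>t. t ^ k * w (c + t * (x - c))) integrable_on {0..1}"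
proof (rule integrable_continuous_interval)
  have "continuous_on {0..1} (\<lambda>t. w (c + t * (x - c)))"
    by (rule continuous_on_compose2[OF cont])
       (use convex_step_in_Icc[OF c x] in \<open>auto intro!: continuous_intros\<close>)
  thus "continuous_on {0..1} (\<lambda>t. t ^ k * w (c + t * (x - c)))"
    by (intro continuous_intros)
qed

lemma continuous_on_quotient_deriv:
  assumes "continuous_on {a..b} w" and "c \<in> {a..b}"
  shows "continuous_on {a..b} (quotient_deriv c k w)"
  unfolding quotient_deriv_def[abs_def]
  using integral_continuous_on_param[OF continuous_on_quotient_integrand[OF assms, of k]]
  unfolding cbox_interval .

lemma quotient_deriv_0:
  assumes der: "\<And>y. y \<in> {a..b} \<Longrightarrow> (u has_field_derivative w y) (at y within {a..b})"
    and c: "c \<in> {a..b}" and x: "x \<in> {a..b}"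
  shows "(x - c) * quotient_deriv c 0 w x = u x - u c"
proof -
  have "((\<lambda>t. (x - c) * w (c + t * (x - c))) has_integral u (c + 1 * (x - c)) - u (c + 0 * (x - c)))
    {0..1}"
  proof (rule fundamental_theorem_of_calculus)
    fix t :: real assume t: "t \<in> {0..1}"
    have "((u \<circ> (\<lambda>t. c + t * (x - c))) has_field_derivative w (c + t * (x - c)) * (x - c))
      (at t within {0..1})"
    proof (rule DERIV_image_chain)
      show "(u has_field_derivative w (c + t * (x - c)))
        (at (c + t * (x - c)) within (\<lambda>t. c + t * (x - c)) ` {0..1})"
        using convex_step_in_Icc[OF c x] t
        by (intro has_field_derivative_subset[OF der]) auto
    qed (auto intro!: derivative_eq_intros)
    thus "((\<lambda>t. u (c + t * (x - c))) has_vector_derivative (x - c) * w (c + t * (x - c)))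
      (at t within {0..1})"
      by (simp add: o_def has_real_derivative_iff_has_vector_derivative mult.commute)
  qed simp
  from integral_unique[OF this] show ?thesis
    by (simp add: quotient_deriv_def)
qed

lemma quotient_deriv_has_field_derivative:
  assumes der: "\<And>y. y \<in> {a..b} \<Longrightarrow> (w has_field_derivative w' y) (at y within {a..b})"
    and cont: "continuous_on {a..b} w'"
    and c: "c \<in> {a..b}" and x: "x \<in> {a..b}"
  shows "(quotient_deriv c k w has_field_derivative quotient_deriv c (Suc k) w' x)
    (at x within {a..b})"
proof -
  have contw: "continuous_on {a..b} w"
    using der by (rule DERIV_continuous_on)
  have "((\<lambda>x. integral (cbox 0 1) (\<lambda>t. t ^ k * w (c + t * (x - c)))) has_field_derivative
    integral (cbox 0 1) (\<lambda>t. t ^ Suc k * w' (c + t * (x - c)))) (at x within {a..b})"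
  proof (rule leibniz_rule_field_derivative)
    fix x t :: real assume x: "x \<in> {a..b}" and t: "t \<in> cbox 0 1"
    have "((w \<circ> (\<lambda>x. c + t * (x - c))) has_field_derivative w' (c + t * (x - c)) * t)
      (at x within {a..b})"
    proof (rule DERIV_image_chain)
      show "(w has_field_derivative w' (c + t * (x - c)))
        (at (c + t * (x - c)) within (\<lambda>x. c + t * (x - c)) ` {a..b})"
        using convex_step_in_Icc[OF c] x t
        by (intro has_field_derivative_subset[OF der]) auto
    qed (auto intro!: derivative_eq_intros)
    from DERIV_cmult[OF this, of "t ^ k"]
    show "((\<lambda>x. t ^ k * w (c + t * (x - c))) has_field_derivative
        t ^ Suc k * w' (c + t * (x - c))) (at x within {a..b})"
      by (simp add: o_def mult_ac)
  next
    show "continuous_on ({a..b} \<times> cbox 0 1) (\<lambda>(x, t). t ^ Suc k * w' (c + t * (x - c)))"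
      by (rule continuous_on_quotient_integrand[OF cont c])
  qed (use quotient_integrand_integrable[OF contw c] x in auto)
  thus ?thesis
    by (simp add: quotient_deriv_def[abs_def])
qed

text \<open>The factor \<open>1 / (k + 2)\<close> is the integral of \<open>t ^ (k + 1)\<close> over \<open>[0, 1]\<close>: one extra power of
  \<open>t\<close> comes from contracting the distance between \<open>x\<close> and \<open>y\<close>.\<close>

lemma quotient_deriv_slope_ge:
  assumes cont: "continuous_on {a..b} w"
    and slope: "\<And>x y. x \<in> {a..b} \<Longrightarrow> y \<in> {a..b} \<Longrightarrow> x \<le> y \<Longrightarrow> L * (y - x) \<le> w y - w x"
    and c: "c \<in> {a..b}" and xy: "x \<in> {a..b}" "y \<in> {a..b}" "x \<le> y"
  shows "L / (real k + 2) * (y - x) \<le> quotient_deriv c k w y - quotient_deriv c k w x"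
proof -
  have pow: "((\<lambda>t::real. t ^ Suc k) has_integral 1 / (real k + 2)) {0..1}"
  proof -
    have "((\<lambda>t::real. t ^ Suc k) has_integral
      1 ^ Suc (Suc k) / (real k + 2) - 0 ^ Suc (Suc k) / (real k + 2)) {0..1}"
    proof (rule fundamental_theorem_of_calculus)
      fix t :: real
      show "((\<lambda>t. t ^ Suc (Suc k) / (real k + 2)) has_vector_derivative t ^ Suc k)
        (at t within {0..1})"
        using DERIV_cdivide[OF DERIV_pow[of "Suc (Suc k)" t "{0..1}"], of "real k + 2"]
        by (simp add: add_ac del: power_Suc flip: has_real_derivative_iff_has_vector_derivative)
    qed simp
    thus ?thesis by simp
  qed
  have "((\<lambda>t. t ^ Suc k * (L * (y - x))) has_integral 1 / (real k + 2) * (L * (y - x))) {0..1}"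
    by (rule has_integral_mult_left[OF pow])
  moreover have "((\<lambda>t. t ^ k * w (c + t * (y - c)) - t ^ k * w (c + t * (x - c))) has_integral
    quotient_deriv c k w y - quotient_deriv c k w x) {0..1}"
    unfolding quotient_deriv_def using xy
    by (intro has_integral_diff integrable_integral quotient_integrand_integrable[OF cont c])
  ultimately have "1 / (real k + 2) * (L * (y - x)) \<le> quotient_deriv c k w y - quotient_deriv c k w x"
  proof (rule has_integral_le)
    fix t :: real assume t: "t \<in> {0..1}"
    have "L * (c + t * (y - c) - (c + t * (x - c))) \<le> w (c + t * (y - c)) - w (c + t * (x - c))"
      using convex_step_in_Icc[OF c _ t] xy t by (intro slope) (auto intro: mult_left_mono)
    hence "t ^ k * (L * (t * (y - x))) \<le> t ^ k * (w (c + t * (y - c)) - w (c + t * (x - c)))"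
      using t by (intro mult_left_mono) (auto simp: algebra_simps)
    thus "t ^ Suc k * (L * (y - x)) \<le> t ^ k * w (c + t * (y - c)) - t ^ k * w (c + t * (x - c))"
      by (simp add: algebra_simps)
  qed
  thus ?thesis by simp
qed

text \<open>Here \<open>U k\<close> is the \<open>k\<close>-th derivative of \<open>U 0\<close>, and the last hypothesis stands for
  \<open>U (m + 1) \<ge> (m + 1)!\<close>.\<close>

lemma monic_poly_below_chain:
  fixes U :: "nat \<Rightarrow> real \<Rightarrow> real"
  assumes "a < b"
    and "\<And>k x. k < m \<Longrightarrow> x \<in> {a..b} \<Longrightarrow> (U k has_field_derivative U (Suc k) x) (at x within {a..b})"
    and "continuous_on {a..b} (U m)"
    and "\<And>x y. x \<in> {a..b} \<Longrightarrow> y \<in> {a..b} \<Longrightarrow> x \<le> y \<Longrightarrow> fact (Suc m) * (y - x) \<le> U m y - U m x"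
  shows "\<exists>Q\<in>monic_polys (Suc m). \<forall>x\<in>{a..b}. \<bar>poly Q x\<bar> \<le> \<bar>U 0 x\<bar>"
  using assms(2-)
proof (induction m arbitrary: U)
  case 0
  have "a \<le> b" using \<open>a < b\<close> by simp
  then obtain c where c: "c \<in> {a..b}" and le: "\<And>x. x \<in> {a..b} \<Longrightarrow> \<bar>U 0 x - U 0 c\<bar> \<le> \<bar>U 0 x\<bar>"
    using exists_abs_diff_le_abs[OF _ "0.prems"(2)] by metis
  have "\<bar>x - c\<bar> \<le> \<bar>U 0 x\<bar>" if x: "x \<in> {a..b}" for x
    using "0.prems"(3)[OF x c] "0.prems"(3)[OF c x] le[OF x] by (cases "x \<le> c") auto
  thus ?case
    by (intro bexI[of _ "[:-c, 1:]"]) (auto simp: monic_polys_def)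
next
  case (Suc m)
  have cont: "continuous_on {a..b} (U k)" if "k \<le> Suc m" for k
    using that Suc.prems(2) DERIV_continuous_on[OF Suc.prems(1)]
    by (cases "k = Suc m") auto
  have "a \<le> b" using \<open>a < b\<close> by simp
  then obtain c where c: "c \<in> {a..b}" and le: "\<And>x. x \<in> {a..b} \<Longrightarrow> \<bar>U 0 x - U 0 c\<bar> \<le> \<bar>U 0 x\<bar>"
    using exists_abs_diff_le_abs[OF _ cont[of 0]] by (metis le0)
  define V where "V k = quotient_deriv c k (U (Suc k))" for k
  have "\<exists>Q\<in>monic_polys (Suc m). \<forall>x\<in>{a..b}. \<bar>poly Q x\<bar> \<le> \<bar>V 0 x\<bar>"
  proof (rule Suc.IH)
    show "(V k has_field_derivative V (Suc k) x) (at x within {a..b})"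
      if "k < m" "x \<in> {a..b}" for k x
      unfolding V_def using that c
      by (intro quotient_deriv_has_field_derivative Suc.prems(1) cont) auto
    show "continuous_on {a..b} (V m)"
      unfolding V_def by (intro continuous_on_quotient_deriv cont c) auto
    show "fact (Suc m) * (y - x) \<le> V m y - V m x"
      if "x \<in> {a..b}" "y \<in> {a..b}" "x \<le> y" for x y
    proof -
      have "fact (Suc (Suc m)) / (real m + 2) * (y - x) \<le> V m y - V m x"
        unfolding V_def
        by (rule quotient_deriv_slope_ge[OF Suc.prems(2) Suc.prems(3) c that])
      moreover have "fact (Suc (Suc m)) = (real m + 2) * fact (Suc m)"
        unfolding fact_Suc[of "Suc m"] by simp
      ultimately show ?thesis by (simp del: fact_Suc)
    qed
  qed
  then obtain Q where Q: "degree Q = Suc m" "lead_coeff Q = 1"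
    and Qle: "\<And>x. x \<in> {a..b} \<Longrightarrow> \<bar>poly Q x\<bar> \<le> \<bar>V 0 x\<bar>"
    by (auto simp: monic_polys_def)
  have "\<bar>poly ([:-c, 1:] * Q) x\<bar> \<le> \<bar>U 0 x\<bar>" if x: "x \<in> {a..b}" for x
  proof -
    have "\<bar>poly ([:-c, 1:] * Q) x\<bar> = \<bar>x - c\<bar> * \<bar>poly Q x\<bar>"
      by (simp add: abs_mult[symmetric] algebra_simps)
    also have "\<dots> \<le> \<bar>x - c\<bar> * \<bar>V 0 x\<bar>"
      using Qle[OF x] by (intro mult_left_mono) auto
    also have "\<dots> = \<bar>U 0 x - U 0 c\<bar>"
      unfolding V_def abs_mult[symmetric]
      by (subst quotient_deriv_0[OF Suc.prems(1)[OF zero_less_Suc] c x]) auto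
    also have "\<dots> \<le> \<bar>U 0 x\<bar>" by (rule le[OF x])
    finally show ?thesis .
  qed
  moreover have "[:-c, 1:] * Q \<in> monic_polys (Suc (Suc m))"
  proof -
    have "Q \<noteq> 0" using Q by auto
    hence "degree ([:-c, 1:] * Q) = Suc (Suc m)"
      using Q by (subst degree_mult_eq) auto
    moreover have "lead_coeff ([:-c, 1:] * Q) = 1"
      using Q by (subst lead_coeff_mult) auto
    ultimately show ?thesis by (simp only: monic_polys_def mem_Collect_eq)
  qed
  ultimately show ?case by blast
qed

section \<open>From the class of functions to pointwise domination\<close>

text \<open>A weak form of Darboux's theorem: by the mean value theorem \<open>g\<close> expands distances by the factor
  \<open>L\<close>, so it is injective and, being continuous, monotone.\<close>

lemma abs_deriv_ge_imp_slope_ge: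
  fixes g g' :: "real \<Rightarrow> real"
  assumes "0 < L" and cont: "continuous_on {a..b} g"
    and der: "\<And>x. x \<in> {a<..<b} \<Longrightarrow> (g has_field_derivative g' x) (at x)"
    and lower: "\<And>x. x \<in> {a<..<b} \<Longrightarrow> L \<le> \<bar>g' x\<bar>"
  obtains s where "\<bar>s\<bar> = (1 :: real)"
    "\<And>x y. x \<in> {a..b} \<Longrightarrow> y \<in> {a..b} \<Longrightarrow> x \<le> y \<Longrightarrow> L * (y - x) \<le> s * g y - s * g x"
proof -
  have expand: "L * (y - x) \<le> \<bar>g y - g x\<bar>"
    if xy: "x \<in> {a..b}" "y \<in> {a..b}" "x < y" for x y
  proof -
    obtain \<xi> where \<xi>: "x < \<xi>" "\<xi> < y" "g y - g x = g' \<xi> * (y - x)"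
    proof (rule mvt[of x y g "\<lambda>\<xi> h. g' \<xi> * h"])
      show "continuous_on {x..y} g"
        using xy by (intro continuous_on_subset[OF cont]) auto
      show "(g has_derivative (\<lambda>h. g' \<xi> * h)) (at \<xi>)" if "x < \<xi>" "\<xi> < y" for \<xi>
        using der[of \<xi>] that xy by (simp add: has_field_derivative_def)
    qed (use xy in auto)
    have "L * (y - x) \<le> \<bar>g' \<xi>\<bar> * (y - x)"
      using lower[of \<xi>] \<xi> xy by (intro mult_right_mono) auto
    thus ?thesis using \<xi> by (simp add: abs_mult)
  qed
  have expand_pos: "0 < \<bar>g y - g x\<bar>" if "x \<in> {a..b}" "y \<in> {a..b}" "x < y" for x y
    using expand[OF that] \<open>0 < L\<close> that mult_pos_pos[of L "y - x"] by linarith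
  have "inj_on g {a..b}"
    by (rule linorder_inj_onI') (use expand_pos in force)
  hence "strict_mono_on {a..b} g \<or> strict_antimono_on {a..b} g"
    using injective_eq_monotone_map[OF is_interval_cc cont] by blast
  thus thesis
  proof
    assume mono: "strict_mono_on {a..b} g"
    show thesis
    proof (rule that[of 1])
      show "L * (y - x) \<le> 1 * g y - 1 * g x" if "x \<in> {a..b}" "y \<in> {a..b}" "x \<le> y" for x y
        using expand[of x y] strict_mono_onD[OF mono, of x y] that by (cases "x = y") auto
    qed simp
  next
    assume anti: "strict_antimono_on {a..b} g"
    show thesis
    proof (rule that[of "- 1"])
      show "L * (y - x) \<le> - 1 * g y - - 1 * g x" if "x \<in> {a..b}" "y \<in> {a..b}" "x \<le> y" for x y
        using expand[of x y] monotone_onD[OF anti, of x y] that by (cases "x = y") auto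
    qed simp
  qed
qed

lemma D_class_continuous_on:
  assumes "0 < n" "f \<in> D_class n a b"
  shows "continuous_on {a..b} f"
proof -
  have "continuous_on {a..b} (deriv_within {a..b} 0 f)"
    using assms unfolding D_class_def by blast
  thus ?thesis by simp
qed

lemma m_inf_le:
  assumes "t \<in> {a<..<b}"
  shows "m_inf n a b f \<le> \<bar>deriv_within {a..b} n f t\<bar>"
proof -
  have "bdd_below ((\<lambda>t. \<bar>deriv_within {a..b} n f t\<bar>) ` {a<..<b})"
    by (rule bdd_belowI2[of _ 0]) simp
  thus ?thesis
    unfolding m_inf_def using assms by (rule cINF_lower)
qed

lemma monic_poly_below:
  assumes "0 < n" "a < b" and f: "f \<in> D_class n a b" and m: "m_inf n a b f = fact n"
  shows "\<exists>Q\<in>monic_polys n. \<forall>x\<in>{a..b}. \<bar>poly Q x\<bar> \<le> \<bar>f x\<bar>"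
proof -
  obtain m where n: "n = Suc m" using \<open>0 < n\<close> gr0_implies_Suc by blast
  let ?F = "\<lambda>k. deriv_within {a..b} k f"
  have cont: "continuous_on {a..b} (?F m)"
    using f n by (auto simp: D_class_def)
  have der: "(?F k has_field_derivative ?F (Suc k) x) (at x within {a..b})"
    if "k < m" "x \<in> {a..b}" for k x
  proof -
    have "?F k differentiable (at x within {a..b})"
      using f n that by (auto simp: D_class_def differentiable_on_def)
    from this[unfolded vector_derivative_works] show ?thesis
      by (simp add: has_real_derivative_iff_has_vector_derivative)
  qed
  have der_last: "(?F m has_field_derivative ?F n x) (at x)" if x: "x \<in> {a<..<b}" for x
  proof -
    have "at x within {a<..<b} = at x"
      using x by (intro at_within_open) auto
    moreover have "at x within {a..b} = at x"
      using x by (intro at_within_Icc_at) auto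
    moreover have "?F m differentiable (at x within {a<..<b})"
      using f n x by (auto simp: D_class_def differentiable_on_def)
    ultimately show ?thesis
      using n vector_derivative_works[of "?F m" "at x"]
      by (simp add: has_real_derivative_iff_has_vector_derivative)
  qed
  obtain s :: real where s: "\<bar>s\<bar> = 1" and slope:
    "\<And>x y. x \<in> {a..b} \<Longrightarrow> y \<in> {a..b} \<Longrightarrow> x \<le> y \<Longrightarrow> fact n * (y - x) \<le> s * ?F m y - s * ?F m x"
  proof (rule abs_deriv_ge_imp_slope_ge[OF _ cont der_last, of "fact n"])
    show "fact n \<le> \<bar>?F n x\<bar>" if "x \<in> {a<..<b}" for x
      using m_inf_le[OF that, of n f] m by simp
  qed (use that in auto)
  have "\<exists>Q\<in>monic_polys (Suc m). \<forall>x\<in>{a..b}. \<bar>poly Q x\<bar> \<le> \<bar>s * ?F 0 x\<bar>"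
  proof (rule monic_poly_below_chain[OF \<open>a < b\<close>, where U = "\<lambda>k x. s * ?F k x"])
    show "((\<lambda>x. s * ?F k x) has_field_derivative s * ?F (Suc k) x) (at x within {a..b})"
      if "k < m" "x \<in> {a..b}" for k x
      by (rule DERIV_cmult[OF der[OF that]])
    show "continuous_on {a..b} (\<lambda>x. s * ?F m x)"
      by (intro continuous_intros cont)
  qed (use slope n in blast)
  thus ?thesis using s n by (simp add: abs_mult)
qed

section \<open>Polynomials belong to the class\<close>

lemma deriv_within_poly:
  assumes "a < b" "x \<in> {a..b}"
  shows "deriv_within {a..b} k (poly Q) x = poly ((pderiv ^^ k) Q) x"
  using assms(2)
proof (induction k arbitrary: x)
  case (Suc k)
  have "(poly ((pderiv ^^ k) Q) has_vector_derivative poly ((pderiv ^^ Suc k) Q) x)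
    (at x within {a..b})"
    by (simp add: poly_DERIV has_field_derivative_at_within
        flip: has_real_derivative_iff_has_vector_derivative)
  hence "(deriv_within {a..b} k (poly Q) has_vector_derivative poly ((pderiv ^^ Suc k) Q) x)
    (at x within {a..b})"
    using Suc by (intro has_vector_derivative_transform[OF Suc.prems Suc.IH])
  thus ?case
    using vector_derivative_within_closed_interval[OF assms(1) Suc.prems] by simp
qed simp

lemma differentiable_on_poly:
  fixes Q :: "real poly"
  shows "poly Q differentiable_on S"
  unfolding differentiable_on_def
  by (rule ballI, rule differentiable_at_withinI, rule poly_differentiable)

lemma poly_in_D_class:
  assumes "a < b"
  shows "poly Q \<in> D_class n a b"
proof -
  have diff: "deriv_within {a..b} k (poly Q) differentiable_on S" if "S \<subseteq> {a..b}" for k S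
    unfolding differentiable_on_def differentiable_def
  proof
    fix x assume x: "x \<in> S"
    then obtain D where "(poly ((pderiv ^^ k) Q) has_derivative D) (at x within S)"
      using differentiable_on_poly[of "(pderiv ^^ k) Q" S]
      by (auto simp: differentiable_on_def differentiable_def)
    hence "(deriv_within {a..b} k (poly Q) has_derivative D) (at x within S)"
    proof (rule has_derivative_transform[OF x, rotated])
      show "deriv_within {a..b} k (poly Q) y = poly ((pderiv ^^ k) Q) y" if "y \<in> S" for y
        using that \<open>S \<subseteq> {a..b}\<close> by (intro deriv_within_poly assms) blast
    qed
    thus "\<exists>D. (deriv_within {a..b} k (poly Q) has_derivative D) (at x within S)"
      by blast
  qed
  show ?thesis
    unfolding D_class_def
    using greaterThanLessThan_subseteq_atLeastAtMost_iff[of a b a b]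
    by (simp add: diff differentiable_imp_continuous_on)
qed

lemma m_inf_monic_poly:
  assumes "a < b" "Q \<in> monic_polys n"
  shows "m_inf n a b (poly Q) = fact n"
proof -
  have "degree ((pderiv ^^ n) Q) = 0"
    using assms(2) by (simp add: degree_higher_pderiv monic_polys_def)
  moreover have "coeff ((pderiv ^^ n) Q) 0 = fact n"
    using assms(2) by (auto simp: coeff_higher_pderiv monic_polys_def pochhammer_fact)
  ultimately have "poly ((pderiv ^^ n) Q) x = fact n" for x
    by (auto elim!: degree_eq_zeroE)
  hence "\<bar>deriv_within {a..b} n (poly Q) t\<bar> = fact n" if "t \<in> {a<..<b}" for t
    using deriv_within_poly[OF assms(1)] that by auto
  thus ?thesis
    unfolding m_inf_def using assms(1) by (subst INF_cong[OF refl]) auto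
qed

section \<open>Comparison of norms\<close>

lemma Lp_norm_mono:
  assumes "0 < p" "a < b" "continuous_on {a..b} f" "continuous_on {a..b} g"
    and le: "\<And>x. x \<in> {a..b} \<Longrightarrow> \<bar>g x\<bar> \<le> \<bar>f x\<bar>"
  shows "Lp_norm p a b g \<le> Lp_norm p a b f"
proof (cases "p = \<infinity>")
  case True
  have "compact ((\<lambda>t. \<bar>f t\<bar>) ` {a..b})"
    using assms by (intro compact_continuous_image continuous_intros) auto
  hence "bdd_above ((\<lambda>t. \<bar>f t\<bar>) ` {a..b})"
    by (intro bounded_imp_bdd_above compact_imp_bounded)
  hence "(SUP t\<in>{a..b}. \<bar>g t\<bar>) \<le> (SUP t\<in>{a..b}. \<bar>f t\<bar>)"
  proof (rule cSUP_mono[rotated])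
    show "\<exists>s\<in>{a..b}. \<bar>g t\<bar> \<le> \<bar>f s\<bar>" if "t \<in> {a..b}" for t
      using le[OF that] that by (rule bexI)
  qed (use \<open>a < b\<close> in simp)
  thus ?thesis
    using True by (simp add: Lp_norm_def)
next
  case False
  then obtain q where q: "p = ereal q" "0 < q"
    using \<open>0 < p\<close> by (cases p) auto
  have int: "(\<lambda>t. \<bar>h t\<bar> powr q) integrable_on {a..b}" if "continuous_on {a..b} h" for h
    using that q by (intro integrable_continuous_interval continuous_on_powr' continuous_intros) auto
  have "integral {a..b} (\<lambda>t. \<bar>g t\<bar> powr q) \<le> integral {a..b} (\<lambda>t. \<bar>f t\<bar> powr q)"
    using q le assms(3,4) by (intro integral_le int powr_mono2) auto
  moreover have "0 \<le> integral {a..b} (\<lambda>t. \<bar>g t\<bar> powr q)"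
    by (intro integral_nonneg int assms) auto
  ultimately show ?thesis
    using q by (simp add: Lp_norm_def powr_mono2)
qed

lemma Lp_norm_nonneg:
  assumes "0 < p" "a < b" "continuous_on {a..b} f"
  shows "0 \<le> Lp_norm p a b f"
proof -
  have "0 \<le> Lp_norm p a b (\<lambda>x. 0)"
    using \<open>a < b\<close> by (simp add: Lp_norm_def)
  also have "\<dots> \<le> Lp_norm p a b f"
    using assms by (intro Lp_norm_mono) auto
  finally show ?thesis .
qed

theorem proposition1:
  fixes n :: nat and p :: ereal and a b :: real
  assumes "0 < n" and "0 < p" and "a < b"
  shows "D_star n p (fact n) a b = D_star_star n p a b"
proof -
  let ?A = "{Lp_norm p a b f | f. f \<in> D_class n a b \<and> m_inf n a b f = fact n}"
  let ?B = "{Lp_norm p a b (poly Q) | Q. Q \<in> monic_polys n}"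
  have sub: "?B \<subseteq> ?A"
    using poly_in_D_class[OF \<open>a < b\<close>] m_inf_monic_poly[OF \<open>a < b\<close>] by blast
  have bdd: "bdd_below ?A"
    using assms by (intro bdd_belowI[of _ 0]) (auto intro: Lp_norm_nonneg D_class_continuous_on)
  have "monom 1 n \<in> monic_polys n"
    by (simp add: monic_polys_def degree_monom_eq)
  hence ne: "?B \<noteq> {}" by blast
  have dominated: "\<exists>y\<in>?B. y \<le> x" if "x \<in> ?A" for x
  proof -
    from that obtain f where x: "x = Lp_norm p a b f"
      and f: "f \<in> D_class n a b" "m_inf n a b f = fact n" by blast
    obtain Q where "Q \<in> monic_polys n" "\<forall>x\<in>{a..b}. \<bar>poly Q x\<bar> \<le> \<bar>f x\<bar>"
      using monic_poly_below[OF \<open>0 < n\<close> \<open>a < b\<close> f] by blast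
    moreover from this have "Lp_norm p a b (poly Q) \<le> x"
      unfolding x using assms f
      by (intro Lp_norm_mono D_class_continuous_on continuous_intros) auto
    ultimately show ?thesis by blast
  qed
  have "Inf ?A \<le> Inf ?B"
    by (rule cInf_superset_mono[OF ne bdd sub])
  moreover have "Inf ?B \<le> Inf ?A"
    using ne sub bdd_below_mono[OF bdd sub] dominated by (intro cInf_mono) blast+
  ultimately show ?thesis
    unfolding D_star_def D_star_star_def by (rule antisym)
qed

end
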